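(* Let $T$ be a rooted tree all of whose levels are finite, and let $G\leq\operatorname{Aut}(T)$ be a weakly branch group on $T$. Then $P(G)=\{1\}$.
   Context: For a group $G$, the pseudocentre is $P(G)=\bigcap_{x\in G}C_G(x)^G$, where $C_G(x)$ is the centralizer of $x$ in $G$ and, for a subgroup $H\leq G$, $H^G$ is the normal closure of $H$ in $G$. A rooted tree $T$ is a tree with a distinguished root $r$; the $n$-th level is the set of vertices at distance $n$ from $r$; $\operatorname{Aut}(T)$ is the group of all bijections of the vertex set $V(T)$ preserving edge incidence and fixing the root. For a vertex $v$, $T_v$ is the subtree with root $v$ (consisting of $v$ and all its descendants). For $G\leq\operatorname{Aut}(T)$, the rigid vertex stabilizer $\operatorname{rst}_G(v)$ is the subgroup of all elements of $G$ fixing every vertex in $V(T)\setminus V(T_v)$. The group $G$ is weakly branch if it acts transitively on every level of $T$ and $\operatorname{rst}_G(v)\neq\{1\}$ for every $v\in V(T)$. *)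

theory Defs
  imports
    "HOL-Algebra.Coset"
    "HOL-Algebra.Bij"
    "Graph_Theory.Digraph_Component"
begin

subsection \<open>The pseudocentre of a group\<close>

definition centralizer :: "('a, 'b) monoid_scheme \<Rightarrow> 'a \<Rightarrow> 'a set" where
  "centralizer G x = {c \<in> carrier G. c \<otimes>\<^bsub>G\<^esub> x = x \<otimes>\<^bsub>G\<^esub> c}"

definition normal_closure :: "('a, 'b) monoid_scheme \<Rightarrow> 'a set \<Rightarrow> 'a set" where
  "normal_closure G H = \<Inter>{N. N \<lhd> G \<and> H \<subseteq> N}"

definition pseudocentre :: "('a, 'b) monoid_scheme \<Rightarrow> 'a set" where
  "pseudocentre G = (\<Inter>x\<in>carrier G. normal_closure G (centralizer G x))"


subsection \<open>Rooted trees\<close>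

text \<open>
  An undirected simple graph, possibly infinite, is a loop-free symmetric digraph whose arcs
  are pairs of vertices. The predicate \<open>tree\<close> of the library is not suitable here: in a
  symmetric digraph every edge gives a directed cycle \<open>u, v, u\<close> of length 2. Cycles of the
  undirected graph are exactly the directed cycles of length at least 3.
\<close>

locale rooted_tree = pair_bidirected_digraph T
  for T :: "'v pair_pre_digraph" and r :: 'v +
  assumes root_in_verts: "r \<in> pverts T"
    and connected: "Digraph_Component.connected (with_proj T)"
    and acyclic: "\<not> (\<exists>p. pre_digraph.cycle (with_proj T) p \<and> 3 \<le> length p)"

definition vdist :: "'v pair_pre_digraph \<Rightarrow> 'v \<Rightarrow> 'v \<Rightarrow> nat" where
  "vdist T u v = (LEAST n. \<exists>p. pre_digraph.awalk (with_proj T) u p v \<and> length p = n)"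

definition level :: "'v pair_pre_digraph \<Rightarrow> 'v \<Rightarrow> nat \<Rightarrow> 'v set" where
  "level T r n = {v \<in> pverts T. vdist T r v = n}"

text \<open>
  The vertex set of the subtree \<open>T\<^sub>v\<close>: \<open>w\<close> is \<open>v\<close> or a descendant of \<open>v\<close> iff \<open>v\<close> lies on the
  (unique) path from the root to \<open>w\<close>.
\<close>

definition subtree_verts :: "'v pair_pre_digraph \<Rightarrow> 'v \<Rightarrow> 'v \<Rightarrow> 'v set" where
  "subtree_verts T r v = {w \<in> pverts T.
     \<exists>p. pre_digraph.apath (with_proj T) r p w \<and>
         v \<in> set (pre_digraph.awalk_verts (with_proj T) r p)}"


subsection \<open>Groups of automorphisms of a rooted tree\<close>

text \<open>
  As in \<^const>\<open>BijGroup\<close>, automorphisms are extensional functions on the vertex set.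
\<close>

definition tree_Aut :: "'v pair_pre_digraph \<Rightarrow> 'v \<Rightarrow> ('v \<Rightarrow> 'v) monoid" where
  "tree_Aut T r = BijGroup (pverts T)
     \<lparr>carrier := {f \<in> Bij (pverts T). f r = r \<and>
        (\<forall>u\<in>pverts T. \<forall>v\<in>pverts T. (f u, f v) \<in> parcs T \<longleftrightarrow> (u, v) \<in> parcs T)}\<rparr>"

definition rigid_stabilizer ::
    "'v pair_pre_digraph \<Rightarrow> 'v \<Rightarrow> ('v \<Rightarrow> 'v) set \<Rightarrow> 'v \<Rightarrow> ('v \<Rightarrow> 'v) set" where
  "rigid_stabilizer T r G v = {g \<in> G. \<forall>u \<in> pverts T - subtree_verts T r v. g u = u}"

definition weakly_branch :: "'v pair_pre_digraph \<Rightarrow> 'v \<Rightarrow> ('v \<Rightarrow> 'v) set \<Rightarrow> bool" where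
  "weakly_branch T r G \<longleftrightarrow>
     (\<forall>n. \<forall>u\<in>level T r n. \<forall>v\<in>level T r n. \<exists>g\<in>G. g u = v) \<and>
     (\<forall>v\<in>pverts T. rigid_stabilizer T r G v \<noteq> {\<one>\<^bsub>tree_Aut T r\<^esub>})"

end

theory Submission
  imports Defs
begin

text \<open>
  Fix a level \<open>n\<close>. A rigid stabilizer moves something below its vertex, so every vertex has
  arbitrarily deep descendants. One can therefore choose, for the finitely many vertices \<open>v\<close>
  of level \<open>n\<close>, nontrivial elements of rigid stabilizers of descendants of \<open>v\<close> in such a way
  that the least depths at which they move something are pairwise distinct; let \<open>x\<close> be their
  product. An element commuting with \<open>x\<close> preserves the depth at which \<open>x\<close> starts to act below
  a vertex, hence fixes level \<open>n\<close> pointwise. So the centralizer of \<open>x\<close>, and with it its normal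
  closure, lies in the stabilizer of level \<open>n\<close>, and these stabilizers intersect trivially.
\<close>

section \<open>Paths from the root, distances and subtrees\<close>

context rooted_tree
begin

text \<open>By induction on the total length. Two distinct paths either meet at an interior vertex,
  where both split into shorter pairs, or are internally disjoint, and then going along
  \<open>p\<close> and back along \<open>q\<close> is a cycle of the kind that
  \<open>acyclic\<close> forbids.\<close>

lemma apath_unique:
  assumes "apath u p v" "apath u q v"
  shows "p = q"
  using assms
proof (induction "length p + length q" arbitrary: u v p q rule: less_induct)
  case less
  let ?P = "pawalk_verts u p" and ?Q = "pawalk_verts u q"
  have pw: "awalk u p v" "awalk u q v"
    and dist: "distinct ?P" "distinct ?Q"
    using less.prems by (auto simp: apath_def)
  show ?case
  proof (rule ccontr)
    assume neq: "p \<noteq> q"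
    have ne: "p \<noteq> []" "q \<noteq> []"
      using less.prems neq apath_nonempty_ends[of u p v] apath_nonempty_ends[of u q v]
      by (auto simp: apath_Nil_iff)
    show False
    proof (cases "\<exists>x. x \<in> set ?P \<and> x \<in> set ?Q \<and> x \<noteq> u \<and> x \<noteq> v")
      case True
      then obtain x where x: "x \<in> set ?P" "x \<in> set ?Q" "x \<noteq> u" "x \<noteq> v"
        by blast
      obtain p1 p2 where p: "p = p1 @ p2" "awalk u p1 x" "awalk x p2 v"
        using awalk_decomp[OF pw(1) x(1)] by blast
      obtain q1 q2 where q: "q = q1 @ q2" "awalk u q1 x" "awalk x q2 v"
        using awalk_decomp[OF pw(2) x(2)] by blast
      have "apath u p1 x" "apath x p2 v" "apath u q1 x" "apath x q2 v"
        using less.prems p(2,3) q(2,3) unfolding p(1) q(1) by (simp_all add: apath_append_iff)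
      \<comment> \<open>All four pieces being nonempty makes both pairs strictly shorter in total,
        as the induction hypothesis demands.\<close>
      moreover have "p1 \<noteq> []" "p2 \<noteq> []" "q1 \<noteq> []" "q2 \<noteq> []"
        using x p q by (auto simp: awalk_Nil_iff)
      ultimately have "p1 = q1" "p2 = q2"
        using less.hyps[of p1 q1] less.hyps[of p2 q2] p(1) q(1) by auto
      then show False using neq p q by simp
    next
      case False
      let ?c = "p @ rev_path q"
      have verts: "pawalk_verts u ?c = ?P @ tl (rev ?Q)"
        using pw by (subst awalk_verts_append[where v=u]) (auto simp: awalk_verts_rev_path)
      obtain P' where P': "?P = u # P'"
        using pw(1) by (cases p) (auto simp: awalk_simps)
      obtain Q' where Q': "?Q = Q' @ [v]"
        using awalkE'[OF pw(2)] append_butlast_last_id[OF awalk_verts_non_Nil] by metis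
      \<comment> \<open>The tail is \<open>P' @ rev Q'\<close>. Here \<open>P'\<close> omits
        \<open>u\<close> and \<open>Q'\<close> omits \<open>v\<close>, so a vertex common to both
        would be a shared interior vertex.\<close>
      have "distinct (tl (pawalk_verts u ?c))"
        using dist False unfolding verts unfolding P' Q' by auto
      moreover have "awalk u ?c u" using pw by (intro awalk_appendI) simp_all
      ultimately have "cycle ?c" using ne unfolding cycle_def by blast
      moreover have "3 \<le> length ?c"
      proof (rule ccontr)
        assume "\<not> ?thesis"
        moreover have "length (rev_path q) = length q" by (induction q) auto
        ultimately have "length p + length q < 3" by simp
        moreover have "0 < length p" "0 < length q" using ne by auto
        \<comment> \<open>A closed walk of length 2 would consist of two single arcs from
          \<open>u\<close> to \<open>v\<close>; since arcs are pairs of vertices, these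
          coincide.\<close>
        ultimately have "length p = 1" "length q = 1" by linarith+
        then obtain e f where "p = [e]" "q = [f]" by (auto simp: length_Suc_conv)
        then have "e = f" using pw by (simp add: awalk_simps prod_eq_iff)
        then show False using neq \<open>p = [e]\<close> \<open>q = [f]\<close> by simp
      qed
      ultimately show False using acyclic by blast
    qed
  qed
qed

lemma apath_exists:
  assumes "w \<in> pverts T"
  obtains p where "apath r p w"
proof -
  have "r \<rightarrow>\<^sup>*\<^bsub>with_proj T\<^esub> w"
    using connected assms root_in_verts reachable_mk_symmetric_eq[OF pair_sym_arcs]
    by (simp add: Digraph_Component.connected_def strongly_connected_def)
  then show ?thesis using that unfolding reachable_apath by blast
qed

text \<open>A shortest walk repeats no vertex, because cutting out a closed piece would shorten it.
  It is therefore a path, and uniqueness identifies it with \<open>p\<close>.\<close>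

lemma vdist_apath:
  assumes "apath r p w"
  shows "vdist T r w = length p"
proof -
  let ?W = "\<lambda>n. \<exists>q. awalk r q w \<and> length q = n"
  have "?W (LEAST n. ?W n)"
    by (rule LeastI_ex) (use assms in \<open>auto simp: apath_def\<close>)
  then obtain q where q: "awalk r q w" "length q = (LEAST n. ?W n)" by blast
  have "distinct (pawalk_verts r q)"
  proof (rule ccontr)
    assume "\<not> ?thesis"
    then obtain q1 q2 q3 x where "q = q1 @ q2 @ q3" "0 < length q2" "awalk r q1 x" "awalk x q3 w"
      using awalk_not_distinct_decomp[OF q(1)] by blast
    then have "awalk r (q1 @ q3) w" "length q = length (q1 @ q3) + length q2" "0 < length q2"
      by (simp_all add: awalk_appendI del: awalk_append_iff)
    then have "?W (length (q1 @ q3))" "length (q1 @ q3) < (LEAST n. ?W n)"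
      unfolding q(2)[symmetric] by (blast, linarith)
    then show False using not_less_Least by blast
  qed
  with q(1) have "apath r q w" by (simp add: apath_def)
  then have "q = p" using assms by (rule apath_unique)
  then show ?thesis using q(2) by (simp add: vdist_def)
qed

text \<open>Uniqueness of paths replaces the existential in \<open>subtree_verts\<close> by any path
  at hand.\<close>

lemma subtree_verts_iff:
  assumes "apath r p w"
  shows "w \<in> subtree_verts T r v \<longleftrightarrow> v \<in> set (pawalk_verts r p)"
proof -
  have "w \<in> pverts T" using assms by (intro awalk_last_in_verts awalkI_apath)
  moreover have "apath r q w \<longleftrightarrow> q = p" for q
    using apath_unique assms by blast
  ultimately show ?thesis by (simp add: subtree_verts_def)
qed

lemma subtree_vertsE:
  assumes "w \<in> subtree_verts T r v"
  obtains p q where "apath r p v" "apath v q w" "apath r (p @ q) w"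
proof -
  obtain s where s: "apath r s w" "v \<in> set (pawalk_verts r s)"
    using assms unfolding subtree_verts_def awalk_verts_with_proj_eq by blast
  then obtain p q where pq: "s = p @ q" "awalk r p v" "awalk v q w"
    using awalk_decomp[OF awalkI_apath[OF s(1)] s(2)] by blast
  have "apath r (p @ q) w" using s(1) pq(1) by simp
  moreover from this have "apath r p v" "apath v q w"
    using pq(2) by (simp_all add: apath_append_iff)
  ultimately show ?thesis using that by blast
qed

lemma subtree_verts_in_verts: "w \<in> subtree_verts T r v \<Longrightarrow> w \<in> pverts T"
  by (simp add: subtree_verts_def)

lemma subtree_verts_self:
  assumes "v \<in> pverts T"
  shows "v \<in> subtree_verts T r v"
proof -
  obtain p where p: "apath r p v" using assms by (rule apath_exists)
  then have "last (pawalk_verts r p) = v" by (auto simp: apath_def)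
  then have "v \<in> set (pawalk_verts r p)"
    using last_in_set[OF awalk_verts_non_Nil, of r p] by simp
  then show ?thesis by (simp add: subtree_verts_iff[OF p])
qed

lemma subtree_verts_trans:
  assumes "u \<in> subtree_verts T r w" "w \<in> subtree_verts T r v"
  shows "u \<in> subtree_verts T r v"
proof -
  obtain p q where p: "apath r p w" "apath w q u" "apath r (p @ q) u"
    using assms(1) by (rule subtree_vertsE)
  then have "v \<in> set (pawalk_verts r p)"
    using assms(2) subtree_verts_iff by blast
  then show ?thesis
    using set_awalk_verts_append[OF awalkI_apath[OF p(1)] awalkI_apath[OF p(2)]]
    by (simp add: subtree_verts_iff[OF p(3)])
qed

lemma vdist_subtree_verts:
  assumes "w \<in> subtree_verts T r v" "w \<noteq> v"
  shows "vdist T r v < vdist T r w"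
proof -
  obtain p q where p: "apath r p v" "apath v q w" "apath r (p @ q) w"
    using assms(1) by (rule subtree_vertsE)
  moreover have "q \<noteq> []" using p assms by (auto simp: apath_Nil_iff)
  ultimately show ?thesis by (simp add: vdist_apath)
qed

text \<open>Both vertices lie on the one path from the root to \<open>w\<close>, at equal distance
  from the root, so the initial segments ending there agree.\<close>

lemma subtree_verts_disjoint:
  assumes "w \<in> subtree_verts T r u" "w \<in> subtree_verts T r v" "vdist T r u = vdist T r v"
  shows "u = v"
proof -
  obtain p q where p: "apath r p u" "apath r (p @ q) w"
    using assms(1) by (rule subtree_vertsE)
  obtain p' q' where p': "apath r p' v" "apath r (p' @ q') w"
    using assms(2) by (rule subtree_vertsE)
  have "p @ q = p' @ q'" using p(2) p'(2) by (rule apath_unique)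
  moreover have "length p = length p'" using assms(3) p(1) p'(1) by (simp add: vdist_apath)
  ultimately have "p = p'" by simp
  then show ?thesis using p(1) p'(1) by (metis awalkI_apath awalkE')
qed

section \<open>Automorphisms and their action on paths, levels and subtrees\<close>

abbreviation "Aut \<equiv> tree_Aut T r"

lemma tree_Aut_simps:
  shows tree_Aut_carrier: "carrier Aut = {f \<in> Bij (pverts T). f r = r \<and>
      (\<forall>u\<in>pverts T. \<forall>v\<in>pverts T. (f u, f v) \<in> parcs T \<longleftrightarrow> (u, v) \<in> parcs T)}"
    and tree_Aut_one: "\<one>\<^bsub>Aut\<^esub> = (\<lambda>x\<in>pverts T. x)"
    and tree_Aut_mult: "\<lbrakk>f \<in> carrier Aut; g \<in> carrier Aut; v \<in> pverts T\<rbrakk> \<Longrightarrow> (f \<otimes>\<^bsub>Aut\<^esub> g) v = f (g v)"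
  by (auto simp: tree_Aut_def BijGroup_def compose_def)

lemma group_tree_Aut: "group Aut"
proof -
  let ?B = "BijGroup (pverts T)"
  interpret B: group ?B by (rule group_BijGroup)
  have carrier_B: "carrier ?B = Bij (pverts T)" by (simp add: BijGroup_def)
  have mult: "(f \<otimes>\<^bsub>?B\<^esub> g) v = f (g v)"
    if "f \<in> carrier ?B" "g \<in> carrier ?B" "v \<in> pverts T" for f g v
    using that by (auto simp: BijGroup_def compose_def)
  have maps: "f v \<in> pverts T" if "f \<in> carrier ?B" "v \<in> pverts T" for f v
    using that Bij_imp_funcset by (auto simp: BijGroup_def)
  have "subgroup (carrier Aut) ?B"
  proof (rule B.subgroupI)
    show "carrier Aut \<subseteq> carrier ?B" by (auto simp: tree_Aut_carrier BijGroup_def)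
    have "\<one>\<^bsub>Aut\<^esub> \<in> carrier Aut"
      using root_in_verts by (auto simp: tree_Aut_carrier tree_Aut_one id_Bij)
    then show "carrier Aut \<noteq> {}" by blast
  next
    fix f assume f: "f \<in> carrier Aut"
    let ?g = "inv\<^bsub>?B\<^esub> f"
    have fB: "f \<in> carrier ?B" using f by (auto simp: tree_Aut_carrier BijGroup_def)
    then have gB: "?g \<in> carrier ?B" by simp
    have gf: "?g (f v) = v" and fg: "f (?g v) = v" if "v \<in> pverts T" for v
      using B.l_inv[OF fB] B.r_inv[OF fB] mult[OF fB gB that] mult[OF gB fB that] that
      by (auto simp: BijGroup_def)
    have "?g r = r" using gf[OF root_in_verts] f by (simp add: tree_Aut_carrier)
    \<comment> \<open>Since \<open>f\<close> both preserves and reflects arcs, its condition at the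
      preimages \<open>?g u\<close> and \<open>?g v\<close> gives the condition for the
      inverse.\<close>
    moreover have "(?g u, ?g v) \<in> parcs T \<longleftrightarrow> (u, v) \<in> parcs T"
      if "u \<in> pverts T" "v \<in> pverts T" for u v
    proof -
      have "(f (?g u), f (?g v)) \<in> parcs T \<longleftrightarrow> (?g u, ?g v) \<in> parcs T"
        using f maps[OF gB] that by (simp add: tree_Aut_carrier)
      then show ?thesis using that by (simp add: fg)
    qed
    moreover have "?g \<in> Bij (pverts T)" using gB unfolding carrier_B .
    ultimately show "?g \<in> carrier Aut" unfolding tree_Aut_carrier by blast
  next
    fix f g assume f: "f \<in> carrier Aut" and g: "g \<in> carrier Aut"
    then have B: "f \<in> carrier ?B" "g \<in> carrier ?B"
      by (auto simp: tree_Aut_carrier BijGroup_def)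
    moreover from this have "f \<otimes>\<^bsub>?B\<^esub> g \<in> Bij (pverts T)"
      unfolding carrier_B[symmetric] by (rule B.m_closed)
    ultimately show "f \<otimes>\<^bsub>?B\<^esub> g \<in> carrier Aut"
      using f g maps root_in_verts by (simp add: tree_Aut_carrier mult)
  qed
  moreover have "?B\<lparr>carrier := carrier Aut\<rparr> = Aut"
    by (simp add: tree_Aut_def)
  ultimately show ?thesis using subgroup.subgroup_is_group B.is_group by fastforce
qed

context
  fixes f
  assumes f: "f \<in> carrier Aut"
begin

lemma Aut_in_verts: "v \<in> pverts T \<Longrightarrow> f v \<in> pverts T"
  using f Bij_imp_funcset by (auto simp: tree_Aut_carrier)

lemma Aut_inj: "\<lbrakk>u \<in> pverts T; v \<in> pverts T\<rbrakk> \<Longrightarrow> f u = f v \<longleftrightarrow> u = v"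
  using f by (auto simp: tree_Aut_carrier Bij_def bij_betw_def inj_on_def)

lemma Aut_awalk:
  assumes "awalk u p v"
  shows "awalk (f u) (map (map_prod f f) p) (f v)"
    and "pawalk_verts (f u) (map (map_prod f f) p) = map f (pawalk_verts u p)"
  using assms
proof (induction p arbitrary: u)
  case Nil
  { case 1 then show ?case by (auto simp: awalk_Nil_iff Aut_in_verts) }
  { case 2 then show ?case by simp }
next
  case (Cons e p)
  { case 1
    then have "(f (fst e), f (snd e)) \<in> parcs T"
      using f wellformed by (auto simp: awalk_Cons_iff tree_Aut_carrier)
    with 1 Cons.IH(1)[of "snd e"] show ?case by (cases e) (auto simp: awalk_Cons_iff) }
  { case 2 with Cons.IH(2)[of "snd e"] show ?case by (auto simp: awalk_Cons_iff) }
qed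

lemma Aut_apath:
  assumes "apath u p v"
  shows "apath (f u) (map (map_prod f f) p) (f v)"
proof -
  have w: "awalk u p v" using assms by (rule awalkI_apath)
  then have "set (pawalk_verts u p) \<subseteq> pverts T" by blast
  then have "inj_on f (set (pawalk_verts u p))" using Aut_inj by (auto intro!: inj_onI)
  then show ?thesis using assms Aut_awalk[OF w] by (simp add: apath_def distinct_map)
qed

lemma Aut_root: "f r = r"
  using f by (simp add: tree_Aut_carrier)

lemma vdist_Aut:
  assumes "v \<in> pverts T"
  shows "vdist T r (f v) = vdist T r v"
proof -
  obtain p where p: "apath r p v" using assms by (rule apath_exists)
  then show ?thesis
    using Aut_apath[OF p] by (simp add: Aut_root vdist_apath)
qed

lemma Aut_subtree_verts:
  assumes "w \<in> subtree_verts T r v"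
  shows "f w \<in> subtree_verts T r (f v)"
proof -
  obtain p where p: "apath r p w" "v \<in> set (pawalk_verts r p)"
    using assms by (auto simp: subtree_verts_def)
  then show ?thesis
    using subtree_verts_iff[of "map (map_prod f f) p" "f w" "f v"]
      Aut_apath[OF p(1)] Aut_awalk(2)[OF awalkI_apath[OF p(1)]]
    by (simp add: Aut_root)
qed

end

end

section \<open>Rigid stabilizers in a weakly branch group\<close>

locale weakly_branch_group = rooted_tree T r
  for T :: "'v pair_pre_digraph" and r :: 'v +
  fixes G :: "('v \<Rightarrow> 'v) set"
  assumes finite_level: "finite (level T r n)"
    and subgroup_G: "subgroup G Aut"
    and weakly_branch: "weakly_branch T r G"
begin

sublocale Aut: group Aut by (rule group_tree_Aut)

lemma G_Aut: "g \<in> G \<Longrightarrow> g \<in> carrier Aut"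
  using subgroup_G by (rule subgroup.mem_carrier)

lemma mult_apply: "\<lbrakk>g \<in> G; h \<in> G; v \<in> pverts T\<rbrakk> \<Longrightarrow> (g \<otimes>\<^bsub>Aut\<^esub> h) v = g (h v)"
  by (simp add: tree_Aut_mult G_Aut)

lemma inv_apply: "\<lbrakk>g \<in> G; v \<in> pverts T\<rbrakk> \<Longrightarrow> (inv\<^bsub>Aut\<^esub> g) (g v) = v"
  using mult_apply[of "inv\<^bsub>Aut\<^esub> g" g v] subgroup_G
  by (simp add: subgroup.m_inv_closed G_Aut tree_Aut_one)

lemma Aut_eqI:
  assumes "g \<in> G" "h \<in> G" "\<And>v. v \<in> pverts T \<Longrightarrow> g v = h v"
  shows "g = h"
  using assms G_Aut[OF assms(1)] G_Aut[OF assms(2)]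
  by (auto simp: tree_Aut_carrier Bij_def intro: extensionalityI)

lemma rigid_stabilizer_moves:
  assumes v: "v \<in> pverts T"
  obtains g w where "g \<in> rigid_stabilizer T r G v" "w \<in> subtree_verts T r v" "g w \<noteq> w"
proof -
  have one: "\<one>\<^bsub>Aut\<^esub> \<in> G" using subgroup_G by (rule subgroup.one_closed)
  \<comment> \<open>As the identity belongs to the stabilizer, differing from the trivial singleton
    yields a nontrivial element and not merely an empty set.\<close>
  then have "\<one>\<^bsub>Aut\<^esub> \<in> rigid_stabilizer T r G v"
    by (auto simp: rigid_stabilizer_def tree_Aut_one)
  moreover have "rigid_stabilizer T r G v \<noteq> {\<one>\<^bsub>Aut\<^esub>}"
    using weakly_branch v by (simp add: weakly_branch_def)
  ultimately obtain g where g: "g \<in> rigid_stabilizer T r G v" "g \<noteq> \<one>\<^bsub>Aut\<^esub>" by blast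
  then obtain w where "w \<in> pverts T" "g w \<noteq> w"
    using Aut_eqI[of g "\<one>\<^bsub>Aut\<^esub>"] one by (auto simp: rigid_stabilizer_def tree_Aut_one)
  with g(1) show ?thesis by (intro that[of g w]) (auto simp: rigid_stabilizer_def)
qed

text \<open>If \<open>v\<close> were moved, its image would lie on the same level and so outside the
  subtree at \<open>v\<close>. Then \<open>g\<close> would fix that image, contradicting
  injectivity.\<close>

lemma rigid_stabilizer_fixes:
  assumes "g \<in> rigid_stabilizer T r G v" "v \<in> pverts T"
  shows "g v = v"
proof (rule ccontr)
  have g: "g \<in> carrier Aut" using assms G_Aut by (auto simp: rigid_stabilizer_def)
  then have gv: "g v \<in> pverts T" using assms(2) by (rule Aut_in_verts)
  assume neq: "g v \<noteq> v"
  then have "g v \<notin> subtree_verts T r v"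
    using subtree_verts_disjoint subtree_verts_self[OF gv] vdist_Aut[OF g assms(2)] by metis
  then have "g (g v) = g v" using assms(1) gv by (simp add: rigid_stabilizer_def)
  then show False using Aut_inj[OF g gv assms(2)] neq by simp
qed

text \<open>A nontrivial element of the rigid stabilizer of \<open>w\<close> moves some vertex below
  \<open>w\<close> but fixes \<open>w\<close>, so that vertex is a proper descendant; iterating this
  reaches any depth.\<close>

lemma deep_descendant:
  assumes "v \<in> pverts T"
  obtains w where "w \<in> subtree_verts T r v" "n \<le> vdist T r w"
proof -
  have "\<exists>w\<in>subtree_verts T r v. n \<le> vdist T r w"
  proof (induction n)
    case 0
    then show ?case using subtree_verts_self[OF assms] by auto
  next
    case (Suc n)
    then obtain w where w: "w \<in> subtree_verts T r v" "n \<le> vdist T r w" by blast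
    then have wV: "w \<in> pverts T" by (simp add: subtree_verts_in_verts)
    obtain g u where g: "g \<in> rigid_stabilizer T r G w" "u \<in> subtree_verts T r w" "g u \<noteq> u"
      using wV by (rule rigid_stabilizer_moves)
    then have "u \<noteq> w" using rigid_stabilizer_fixes wV by blast
    with g w show ?case
      using vdist_subtree_verts[of u w] subtree_verts_trans[of u w v] by (auto intro!: bexI[of _ u])
  qed
  then show ?thesis using that by blast
qed

section \<open>Elements that separate the vertices of a level\<close>

definition moved :: "('v \<Rightarrow> 'v) \<Rightarrow> 'v \<Rightarrow> 'v set" where
  "moved x v = {w \<in> subtree_verts T r v. x w \<noteq> w}"

text \<open>Distances are measured from the root, not from \<open>v\<close>. The infimum is an
  attained minimum only if something below \<open>v\<close> is moved, so nonemptiness of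
  \<open>moved x v\<close> accompanies its use below.\<close>

definition depth :: "('v \<Rightarrow> 'v) \<Rightarrow> 'v \<Rightarrow> nat" where
  "depth x v = Inf (vdist T r ` moved x v)"

lemma subtree_verts_level_unique:
  assumes "u \<in> level T r n" "v \<in> level T r n" "w \<in> subtree_verts T r u" "w \<in> subtree_verts T r v"
  shows "u = v"
  using assms subtree_verts_disjoint by (simp add: level_def)

text \<open>The statement concerns subsets of the level so that vertices can be added one at a time.
  Control of the whole support of \<open>x\<close> keeps the old product trivial below the new
  vertex.\<close>

lemma separating_element:
  assumes "S \<subseteq> level T r n"
  shows "\<exists>x\<in>G. {w \<in> pverts T. x w \<noteq> w} = (\<Union>v\<in>S. moved x v)
    \<and> (\<forall>v\<in>S. moved x v \<noteq> {}) \<and> inj_on (depth x) S"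
  using finite_subset[OF assms finite_level] assms
proof (induction S rule: finite_induct)
  case empty
  then show ?case
    using subgroup.one_closed[OF subgroup_G]
    by (auto simp: tree_Aut_one intro!: bexI[of _ "\<one>\<^bsub>Aut\<^esub>"])
next
  case (insert v S)
  then obtain x where x: "x \<in> G" "{w \<in> pverts T. x w \<noteq> w} = (\<Union>v\<in>S. moved x v)"
      "\<forall>v\<in>S. moved x v \<noteq> {}" "inj_on (depth x) S"
    by auto
  have v: "v \<in> pverts T" "v \<in> level T r n" using insert.prems by (auto simp: level_def)
  \<comment> \<open>Going strictly beyond all depths used so far makes the new depth different from
    them. For empty \<open>S\<close> the value of \<open>Max\<close> is irrelevant, as there is
    nothing to compare with.\<close>
  obtain w where w: "w \<in> subtree_verts T r v" "Suc (Max (depth x ` S)) \<le> vdist T r w"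
    using v(1) by (rule deep_descendant)
  then have wV: "w \<in> pverts T" by (simp add: subtree_verts_in_verts)
  obtain y u where y: "y \<in> rigid_stabilizer T r G w" and u: "u \<in> subtree_verts T r w" "y u \<noteq> u"
    using wV by (rule rigid_stabilizer_moves)
  have yG: "y \<in> G" using y by (simp add: rigid_stabilizer_def)
  have sub_w: "subtree_verts T r w \<subseteq> subtree_verts T r v"
    using subtree_verts_trans w(1) by blast
  have disj: "t \<notin> subtree_verts T r v" if "t \<in> subtree_verts T r s" "s \<in> S" for s t
    using that insert subtree_verts_level_unique[of s n v t] v(2) by auto
  \<comment> \<open>The product applies \<open>y\<close> first. The supports are disjoint: that of
    \<open>y\<close> lies below \<open>v\<close>, that of \<open>x\<close> below the vertices of
    \<open>S\<close>.\<close>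
  let ?z = "x \<otimes>\<^bsub>Aut\<^esub> y"
  have zG: "?z \<in> G" using x(1) yG by (rule subgroup.m_closed[OF subgroup_G])
  have x_fix: "x t = t" if "t \<in> subtree_verts T r v" for t
  proof -
    have "t \<notin> moved x s" if "s \<in> S" for s
      using that disj[of t s] \<open>t \<in> subtree_verts T r v\<close> by (auto simp: moved_def)
    then show ?thesis using x(2) subtree_verts_in_verts[OF that] by blast
  qed
  have y_fix: "y t = t" if "t \<in> pverts T" "t \<notin> subtree_verts T r w" for t
    using y that by (simp add: rigid_stabilizer_def)
  \<comment> \<open>Because \<open>y\<close> fixes \<open>w\<close>, it maps the subtree at
    \<open>w\<close> into itself, and it fixes everything else. Hence \<open>x\<close>, applied
    afterwards, acts trivially on the image.\<close>
  have y_stable: "y t \<in> subtree_verts T r v" if "t \<in> subtree_verts T r v" for t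
  proof (cases "t \<in> subtree_verts T r w")
    case True
    then show ?thesis
      using Aut_subtree_verts[OF G_Aut[OF yG] True] rigid_stabilizer_fixes[OF y wV] sub_w by auto
  next
    case False
    then show ?thesis using y_fix subtree_verts_in_verts[OF that] that by simp
  qed
  have z_in: "?z t = y t" if "t \<in> subtree_verts T r v" for t
    using x_fix[OF y_stable[OF that]] subtree_verts_in_verts[OF that]
    by (simp add: mult_apply[OF x(1) yG])
  have z_out: "?z t = x t" if "t \<in> pverts T" "t \<notin> subtree_verts T r v" for t
  proof -
    have "y t = t" using y_fix that sub_w by blast
    then show ?thesis using that(1) by (simp add: mult_apply[OF x(1) yG])
  qed
  have moved_S: "moved ?z s = moved x s" if "s \<in> S" for s
  proof -
    have "?z t = x t" if "t \<in> subtree_verts T r s" for t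
      using z_out[OF subtree_verts_in_verts[OF that] disj[OF that \<open>s \<in> S\<close>]] .
    then show ?thesis unfolding moved_def by auto
  qed
  have moved_v: "moved ?z v = {t \<in> subtree_verts T r w. y t \<noteq> t}"
  proof -
    have "t \<in> subtree_verts T r w" if "t \<in> subtree_verts T r v" "y t \<noteq> t" for t
      using y_fix that subtree_verts_in_verts[OF that(1)] by blast
    moreover have "moved ?z v = {t \<in> subtree_verts T r v. y t \<noteq> t}"
      using z_in unfolding moved_def by auto
    ultimately show ?thesis using sub_w by blast
  qed
  have "?z t \<noteq> t \<longleftrightarrow> x t \<noteq> t \<or> t \<in> moved ?z v" if "t \<in> pverts T" for t
    using z_out[OF that] x_fix by (cases "t \<in> subtree_verts T r v") (auto simp: moved_def)
  moreover have "moved ?z v \<subseteq> pverts T"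
    using subtree_verts_in_verts unfolding moved_def by blast
  ultimately have "{t \<in> pverts T. ?z t \<noteq> t} = {t \<in> pverts T. x t \<noteq> t} \<union> moved ?z v"
    by blast
  then have 1: "{t \<in> pverts T. ?z t \<noteq> t} = (\<Union>v\<in>insert v S. moved ?z v)"
    using moved_S x(2) by auto
  have ne: "moved ?z v \<noteq> {}" using u moved_v by auto
  \<comment> \<open>All that the product moves below \<open>v\<close> already lies below
    \<open>w\<close>, hence at least as deep as \<open>w\<close>.\<close>
  have "vdist T r w \<le> depth ?z v"
    unfolding depth_def
  proof (rule cInf_greatest)
    show "vdist T r ` moved ?z v \<noteq> {}" using ne by simp
  next
    fix d assume "d \<in> vdist T r ` moved ?z v"
    then obtain t where "t \<in> subtree_verts T r w" "d = vdist T r t" by (auto simp: moved_v)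
    then show "vdist T r w \<le> d" using vdist_subtree_verts[of t w] by (cases "t = w") auto
  qed
  moreover have depth_S: "depth ?z s = depth x s" if "s \<in> S" for s
    using moved_S[OF that] by (simp add: depth_def)
  moreover have "depth x s \<le> Max (depth x ` S)" if "s \<in> S" for s
    using that insert.hyps by simp
  ultimately have "depth ?z s < depth ?z v" if "s \<in> S" for s
    using w(2) that by fastforce
  note less = this
  have "depth ?z v \<notin> depth ?z ` (S - {v})"
  proof
    assume "depth ?z v \<in> depth ?z ` (S - {v})"
    then obtain s where "s \<in> S" "depth ?z v = depth ?z s" by blast
    with less[of s] show False by simp
  qed
  moreover have "inj_on (depth ?z) S"
    using x(4) inj_on_cong[of S "depth ?z" "depth x"] depth_S by blast
  ultimately have "inj_on (depth ?z) (insert v S)" by (simp only: inj_on_insert simp_thms)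
  moreover have "\<forall>s\<in>insert v S. moved ?z s \<noteq> {}" using ne moved_S x(3) by blast
  ultimately show ?case using zG 1 by blast
qed

text \<open>If \<open>x\<close> moves \<open>w\<close> below \<open>v\<close>, then
  \<open>x (c w) = c (x w) \<noteq> c w\<close>, so \<open>x\<close> moves \<open>c w\<close>, which
  lies below \<open>c v\<close> at the same depth as \<open>w\<close>. Apply this to a
  \<open>w\<close> of least depth.\<close>

lemma depth_centralizer_le:
  assumes c: "c \<in> G" and x: "x \<in> G" and comm: "c \<otimes>\<^bsub>Aut\<^esub> x = x \<otimes>\<^bsub>Aut\<^esub> c"
    and ne: "moved x v \<noteq> {}"
  shows "depth x (c v) \<le> depth x v"
proof -
  have "depth x v \<in> vdist T r ` moved x v"
    unfolding depth_def using ne by (intro Inf_nat_def1) simp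
  then obtain w where w: "w \<in> subtree_verts T r v" "x w \<noteq> w" "depth x v = vdist T r w"
    by (auto simp: moved_def)
  then have wV: "w \<in> pverts T" by (simp add: subtree_verts_in_verts)
  note cA = G_Aut[OF c]
  have "x (c w) = c (x w)" using fun_cong[OF comm, of w] c x wV by (simp add: mult_apply)
  also have "\<dots> \<noteq> c w" using Aut_inj[OF cA] w(2) wV Aut_in_verts[OF G_Aut[OF x]] by blast
  finally have "c w \<in> moved x (c v)"
    using Aut_subtree_verts[OF cA w(1)] by (simp add: moved_def)
  then show ?thesis
    using vdist_Aut[OF cA wV] w(3) unfolding depth_def by (metis cInf_lower bdd_below_bot imageI)
qed

section \<open>Level stabilizers and the pseudocentre\<close>

abbreviation "G_group \<equiv> Aut\<lparr>carrier := G\<rparr>"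

lemma group_G: "group G_group"
  using subgroup_G by (rule Aut.subgroup_imp_group)

definition level_stabilizer :: "nat \<Rightarrow> ('v \<Rightarrow> 'v) set" where
  "level_stabilizer n = {g \<in> G. \<forall>v\<in>level T r n. g v = v}"

text \<open>Automorphisms preserve levels, so this is the kernel of the action of \<open>G\<close>
  on level \<open>n\<close>.\<close>

lemma normal_level_stabilizer: "level_stabilizer n \<lhd> G_group"
proof -
  interpret G_group: group G_group by (rule group_G)
  have inv: "inv\<^bsub>G_group\<^esub> g = inv\<^bsub>Aut\<^esub> g" if "g \<in> G" for g
    using Aut.m_inv_consistent[OF subgroup_G that] .
  have closed: "inv\<^bsub>Aut\<^esub> g \<in> G" if "g \<in> G" for g
    using subgroup_G that by (rule subgroup.m_inv_closed)
  have mclosed: "g \<otimes>\<^bsub>Aut\<^esub> h \<in> G" if "g \<in> G" "h \<in> G" for g h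
    using subgroup_G that by (rule subgroup.m_closed)
  have level: "v \<in> pverts T" "g v \<in> level T r n" if "v \<in> level T r n" "g \<in> G" for g v
    using that vdist_Aut[OF G_Aut] Aut_in_verts[OF G_Aut] by (auto simp: level_def)
  let ?N = "{g \<in> G. \<forall>v\<in>level T r n. g v = v}"
  have "subgroup ?N G_group"
  proof (rule G_group.subgroupI)
    show "?N \<noteq> {}"
      using subgroup.one_closed[OF subgroup_G] level
      by (auto simp: tree_Aut_one intro!: exI[of _ "\<one>\<^bsub>Aut\<^esub>"])
  next
    fix g assume g: "g \<in> ?N"
    then have "(inv\<^bsub>Aut\<^esub> g) v = v" if "v \<in> level T r n" for v
      using inv_apply[of g v] level[OF that] that by auto
    then show "inv\<^bsub>G_group\<^esub> g \<in> ?N" using g closed by (auto simp: inv)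
  qed (auto simp: mclosed mult_apply level)
  moreover have "g \<otimes>\<^bsub>Aut\<^esub> h \<otimes>\<^bsub>Aut\<^esub> inv\<^bsub>Aut\<^esub> g \<in> ?N" if g: "g \<in> G" and h: "h \<in> ?N" for g h
  proof -
    have "(g \<otimes>\<^bsub>Aut\<^esub> h \<otimes>\<^bsub>Aut\<^esub> inv\<^bsub>Aut\<^esub> g) v = v" if v: "v \<in> level T r n" for v
    proof -
      have l: "(inv\<^bsub>Aut\<^esub> g) v \<in> level T r n" using v closed[OF g] by (rule level)
      have "(g \<otimes>\<^bsub>Aut\<^esub> h \<otimes>\<^bsub>Aut\<^esub> inv\<^bsub>Aut\<^esub> g) v = g ((inv\<^bsub>Aut\<^esub> g) v)"
        using g h v l level closed mclosed by (simp add: mult_apply)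
      also have "\<dots> = v"
        using mult_apply[of g "inv\<^bsub>Aut\<^esub> g" v] g closed level[OF v g]
        by (simp add: G_Aut tree_Aut_one)
      finally show ?thesis .
    qed
    then show ?thesis using g h closed mclosed by auto
  qed
  ultimately show ?thesis by (simp add: level_stabilizer_def G_group.normal_inv_iff inv)
qed

text \<open>It suffices to find one \<open>x\<close> whose centralizer lies in this normal subgroup;
  \<open>separating_element\<close> for the entire level provides it.\<close>

lemma pseudocentre_level_stabilizer: "pseudocentre G_group \<subseteq> level_stabilizer n"
proof -
  obtain x where x: "x \<in> G" and ne: "\<forall>v\<in>level T r n. moved x v \<noteq> {}"
    and inj: "inj_on (depth x) (level T r n)"
    using separating_element[of "level T r n" n] by auto
  have "centralizer G_group x \<subseteq> level_stabilizer n"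
  proof
    fix c assume "c \<in> centralizer G_group x"
    then have c: "c \<in> G" "c \<otimes>\<^bsub>Aut\<^esub> x = x \<otimes>\<^bsub>Aut\<^esub> c" by (auto simp: centralizer_def)
    let ?d = "inv\<^bsub>Aut\<^esub> c"
    have d: "?d \<in> G" using subgroup_G c(1) by (rule subgroup.m_inv_closed)
    have comm: "?d \<otimes>\<^bsub>Aut\<^esub> x = x \<otimes>\<^bsub>Aut\<^esub> ?d"
      using c x G_Aut by (metis Aut.inv_solve_left Aut.inv_solve_right Aut.m_assoc
          Aut.inv_closed Aut.m_closed)
    have "c v = v" if v: "v \<in> level T r n" for v
    proof -
      have vV: "v \<in> pverts T" using v by (simp add: level_def)
      have cv: "c v \<in> level T r n"
        using v vdist_Aut[OF G_Aut[OF c(1)] vV] Aut_in_verts[OF G_Aut[OF c(1)] vV]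
        by (simp add: level_def)
      have "depth x (c v) \<le> depth x v"
        using c x ne v by (intro depth_centralizer_le) auto
      \<comment> \<open>The inverse also commutes with \<open>x\<close> and takes \<open>c v\<close>
        back to \<open>v\<close>, which reverses the inequality. Injectivity of
        \<open>depth x\<close> on the level then forces \<open>c v = v\<close>.\<close>
      moreover have "depth x (?d (c v)) \<le> depth x (c v)"
        using d comm x ne cv by (intro depth_centralizer_le) auto
      ultimately have "depth x (c v) = depth x v" by (simp add: inv_apply[OF c(1) vV])
      then show ?thesis using inj cv v by (simp only: inj_on_eq_iff)
    qed
    then show "c \<in> level_stabilizer n" using c(1) by (simp add: level_stabilizer_def)
  qed
  then have "normal_closure G_group (centralizer G_group x) \<subseteq> level_stabilizer n"
    using normal_level_stabilizer unfolding normal_closure_def by blast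
  then show ?thesis using x by (auto simp: pseudocentre_def)
qed

text \<open>Each vertex lies on the level given by its own distance from the root, so an element of
  all level stabilizers fixes every vertex.\<close>

lemma pseudocentre_trivial: "pseudocentre G_group = {\<one>\<^bsub>Aut\<^esub>}"
proof -
  have one: "\<one>\<^bsub>Aut\<^esub> \<in> G" using subgroup_G by (rule subgroup.one_closed)
  have "\<one>\<^bsub>Aut\<^esub> \<in> N" if "N \<lhd> G_group" for N
    using subgroup.one_closed[OF normal_imp_subgroup[OF that]] by simp
  then have "\<one>\<^bsub>Aut\<^esub> \<in> pseudocentre G_group"
    by (auto simp: pseudocentre_def normal_closure_def)
  moreover have "g = \<one>\<^bsub>Aut\<^esub>" if g: "g \<in> pseudocentre G_group" for g
  proof (rule Aut_eqI)
    show "g \<in> G"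
      using g pseudocentre_level_stabilizer[of 0] by (auto simp: level_stabilizer_def)
  next
    fix v assume "v \<in> pverts T"
    then show "g v = \<one>\<^bsub>Aut\<^esub> v"
      using g pseudocentre_level_stabilizer[of "vdist T r v"]
      by (auto simp: level_stabilizer_def level_def tree_Aut_one)
  qed (rule one)
  ultimately show ?thesis by blast
qed

end

theorem theorem8p2:
  fixes T :: "'v pair_pre_digraph" and r :: 'v and G :: "('v \<Rightarrow> 'v) set"
  assumes "rooted_tree T r"
    and "\<forall>n. finite (level T r n)"
    and "subgroup G (tree_Aut T r)"
    and "weakly_branch T r G"
  shows "pseudocentre ((tree_Aut T r)\<lparr>carrier := G\<rparr>) = {\<one>\<^bsub>tree_Aut T r\<^esub>}"
proof -
  interpret weakly_branch_group T r G
    using assms by (intro weakly_branch_group.intro weakly_branch_group_axioms.intro) auto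
  show ?thesis by (rule pseudocentre_trivial)
qed

end
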